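(* For every integer $n\ge0$, $spt_o^{-}(2n+1)=spt_o^{+}(2n+1)$.
   Context: For a nonempty integer partition $\pi$, let $s(\pi)$ be its smallest part, and call $\pi$ admissible if no odd part of $\pi$ is greater than $2s(\pi)$. $spt_o^{+}(m)$ is the total number of occurrences of the smallest part, summed over all admissible partitions of $m$. For $l\ge1$ let $\delta_l=(l-1,l-2,\dots,1)$, a partition of size $\binom{l}{2}$. $spt_o^{-}(m)$ is the total number of occurrences of $s(\pi)$ in $\pi$, summed over all pairs $(\pi,\delta_{s(\pi)})$ with $\pi$ admissible and $|\pi|+\binom{s(\pi)}{2}=m$. *)

theory Defs
  imports Complex_Main "HOL-Library.Multiset"
begin

text \<open>An integer partition is a multiset of positive natural numbers; its size is the sum
  of its elements counted with multiplicity.\<close>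

definition is_partition :: "nat multiset \<Rightarrow> bool" where
  "is_partition \<pi> \<longleftrightarrow> 0 \<notin># \<pi>"

text \<open>Only meaningful for nonempty partitions.\<close>

definition smallest_part :: "nat multiset \<Rightarrow> nat" where
  "smallest_part \<pi> = Min (set_mset \<pi>)"

definition admissible :: "nat multiset \<Rightarrow> bool" where
  "admissible \<pi> \<longleftrightarrow> is_partition \<pi> \<and> \<pi> \<noteq> {#} \<and>
     (\<forall>p \<in># \<pi>. odd p \<longrightarrow> \<not> p > 2 * smallest_part \<pi>)"

text \<open>The partition \<open>(l - 1, l - 2, \<dots>, 1)\<close>, which is empty for \<open>l = 1\<close>.\<close>

definition staircase :: "nat \<Rightarrow> nat multiset" where
  "staircase l = mset_set {1..<l}"

definition spt_o_plus :: "nat \<Rightarrow> nat" where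
  "spt_o_plus m =
     (\<Sum>\<pi> \<in> {\<pi>. admissible \<pi> \<and> sum_mset \<pi> = m}. count \<pi> (smallest_part \<pi>))"

text \<open>Occurrences are counted in the first component only, not in the staircase.\<close>

definition spt_o_minus :: "nat \<Rightarrow> nat" where
  "spt_o_minus m =
     (\<Sum>(\<pi>, \<delta>) \<in> {(\<pi>, \<delta>). admissible \<pi> \<and> \<delta> = staircase (smallest_part \<pi>) \<and>
        sum_mset \<pi> + (smallest_part \<pi> choose 2) = m}. count \<pi> (smallest_part \<pi>))"

text \<open>The staircase has the expected size, and both index sets are finite, so the sums above
  do not collapse to zero.\<close>

lemma sum_mset_staircase: "sum_mset (staircase l) = l choose 2"
proof (induction l)
  case 0
  then show ?case by (simp add: staircase_def)
next
  case (Suc l)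
  show ?case
  proof (cases "l = 0")
    case True
    then show ?thesis by (simp add: staircase_def)
  next
    case False
    then have "{1..<Suc l} = insert l {1..<l}" by auto
    then have "staircase (Suc l) = add_mset l (staircase l)"
      by (simp add: staircase_def)
    then show ?thesis using Suc by (simp add: numeral_2_eq_2)
  qed
qed

lemma size_le_sum_mset: "is_partition \<pi> \<Longrightarrow> size \<pi> \<le> sum_mset \<pi>"
  by (induction \<pi>) (auto simp: is_partition_def)

lemma finite_partitions_le: "finite {\<pi>. is_partition \<pi> \<and> sum_mset \<pi> \<le> m}"
proof (rule finite_subset)
  show "{\<pi>. is_partition \<pi> \<and> sum_mset \<pi> \<le> m} \<subseteq> mset ` {xs. set xs \<subseteq> {..m} \<and> length xs \<le> m}"
  proof
    fix \<pi> assume "\<pi> \<in> {\<pi>. is_partition \<pi> \<and> sum_mset \<pi> \<le> m}"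
    then have p: "is_partition \<pi>" "sum_mset \<pi> \<le> m" by auto
    obtain xs where xs: "mset xs = \<pi>" using ex_mset by blast
    have "x \<le> m" if "x \<in> set xs" for x
    proof -
      have "x \<in># \<pi>" using that xs by auto
      then have "x \<le> sum_mset \<pi>" using multi_member_split[of x \<pi>] by auto
      then show ?thesis using p by simp
    qed
    moreover have "length xs \<le> m"
      using size_le_sum_mset[OF p(1)] p(2) xs by auto
    ultimately show "\<pi> \<in> mset ` {xs. set xs \<subseteq> {..m} \<and> length xs \<le> m}"
      using xs by auto
  qed
  show "finite (mset ` {xs. set xs \<subseteq> {..m} \<and> length xs \<le> m})"
    by (intro finite_imageI finite_lists_length_le) simp
qed

lemma finite_spt_o_plus_index: "finite {\<pi>. admissible \<pi> \<and> sum_mset \<pi> = m}"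
  by (rule finite_subset[OF _ finite_partitions_le[of m]]) (auto simp: admissible_def)

lemma finite_spt_o_minus_index:
  "finite {(\<pi>, \<delta>). admissible \<pi> \<and> \<delta> = staircase (smallest_part \<pi>) \<and>
     sum_mset \<pi> + (smallest_part \<pi> choose 2) = m}"
proof (rule finite_subset)
  show "finite ((\<lambda>\<pi>. (\<pi>, staircase (smallest_part \<pi>))) ` {\<pi>. is_partition \<pi> \<and> sum_mset \<pi> \<le> m})"
    using finite_partitions_le by (rule finite_imageI)
qed (auto simp: admissible_def)

end

theory Submission
  imports Defs "HOL-Computational_Algebra.Formal_Laurent_Series"
begin

text \<open>Sorting admissible partitions by their smallest part \<open>n\<close> and multiplying by the even series
  \<open>(q\<^sup>2;q\<^sup>2)\<^sub>\<infinity>\<close>, the two generating functions become \<open>\<Sum> q\<^sup>n b\<^sub>n\<close> and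
  \<open>\<Sum> q\<^bsup>n(n+1)/2\<^esup> b\<^sub>n\<close> with \<open>b\<^sub>n = (q;q)\<^bsub>n-1\<^esub>\<^sup>2 / ((q;q)\<^sub>n (q;q\<^sup>2)\<^sub>n)\<close>.
  Slater's Bailey pair C(1), whose \<open>\<alpha>\<close> is an even series supported on even indices, turns the first
  sum into \<open>\<Sum> q\<^sup>k / (1 - q\<^sup>k)\<^sup>2\<close> plus an even series. The second sum equals
  \<open>\<Sum> q\<^sup>k / (1 - q\<^sup>k)\<^sup>2\<close> over odd \<open>k\<close>, by the first-order part at \<open>z = 1\<close> of Andrews'
  \<open>q\<close>-analogue of Gauss's second theorem with parameters \<open>z\<close> and \<open>1/z\<close>. The terms with even \<open>k\<close>
  contribute even powers only. Both identities are used in finite, telescoping form, where they hold in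
  any field; they are transferred to power series through the field of Laurent series.\<close>

section \<open>Finite q-series identities\<close>

definition qpoch :: "'a::comm_ring_1 \<Rightarrow> nat \<Rightarrow> 'a" where
  "qpoch q n = (\<Prod>k=1..n. 1 - q ^ k)"

definition qpoch_odd :: "'a::comm_ring_1 \<Rightarrow> nat \<Rightarrow> 'a" where
  "qpoch_odd q n = (\<Prod>k=1..n. 1 - q ^ (2 * k - 1))"

lemma qpoch_0 [simp]: "qpoch q 0 = 1"
  by (simp add: qpoch_def)

lemma qpoch_Suc [simp]: "qpoch q (Suc n) = qpoch q n * (1 - q ^ Suc n)"
  by (simp add: qpoch_def)

lemma qpoch_odd_0 [simp]: "qpoch_odd q 0 = 1"
  by (simp add: qpoch_odd_def)

lemma qpoch_odd_Suc [simp]: "qpoch_odd q (Suc n) = qpoch_odd q n * (1 - q ^ (2 * n + 1))"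
  by (simp add: qpoch_odd_def)

text \<open>The reciprocal of \<open>qpoch\<close>, extended by 0 to negative indices as is usual
  for Bailey pairs: sums then terminate by themselves and recurrences in the index have no boundary
  cases.\<close>

definition qinv :: "'a::field \<Rightarrow> int \<Rightarrow> 'a" where
  "qinv q k = (if k < 0 then 0 else 1 / qpoch q (nat k))"

text \<open>For j > 0 this is the entry of index \<open>2 * j\<close> in Slater's alpha sequence,
  whose entries of odd index are 0. The entry of index 0 is 1, whereas the formula gives 2 there; it
  is therefore always written separately.\<close>

definition bailey_alpha :: "'a::comm_ring_1 \<Rightarrow> nat \<Rightarrow> 'a" where
  "bailey_alpha q j = (- 1) ^ j * (q ^ (j * (3 * j - 1)) + q ^ (j * (3 * j + 1)))"

text \<open>The factor with \<open>i = N\<close> is \<open>0\<close>, so the weight vanishes for \<open>n > N\<close>; as \<open>N\<close> grows it tends to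
  \<open>1\<close>.\<close>

definition gauss_weight :: "'a::field \<Rightarrow> nat \<Rightarrow> nat \<Rightarrow> 'a" where
  "gauss_weight q N n = (\<Prod>i<n. (1 - q ^ (2 * (N - i))) / (1 - q ^ (2 * N - i)))"

definition gauss_term :: "'a::field \<Rightarrow> nat \<Rightarrow> nat \<Rightarrow> 'a" where
  "gauss_term q N n = q ^ (n * (n + 1) div 2)
      * (qpoch q (n - 1) ^ 2 / (qpoch q n * qpoch_odd q n)) * gauss_weight q N n"

text \<open>The telescoping relation of \<open>gauss_certificate\<close> divided by its term, with w
  = q^n and v = q^(N - n). On the left stands 1 minus the ratio of the terms for N - 1 and N, on the
  right the difference of the certificate.\<close>

lemma gauss_certificate_identity:
  fixes w v q :: "'a::field"
  assumes "w \<noteq> 0" "q \<noteq> 0" "1 - w * v\<^sup>2 \<noteq> 0" "q - w * v\<^sup>2 \<noteq> 0" "q - w\<^sup>2 * v\<^sup>2 \<noteq> 0"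
    "1 - w * q \<noteq> 0" "1 - w\<^sup>2 * q \<noteq> 0"
  shows "1 - (1 - v\<^sup>2) * (q - w\<^sup>2 * v\<^sup>2) / ((1 - w * v\<^sup>2) * (q - w * v\<^sup>2))
    = v\<^sup>2 * (1 - w) * (q - w\<^sup>2) / ((1 - w * v\<^sup>2) * (q - w\<^sup>2 * v\<^sup>2))
     - w * q * (1 - w)\<^sup>2 / ((1 - w * q) * (1 - w\<^sup>2 * q)) * ((1 - v\<^sup>2) / (1 - w * v\<^sup>2)) *
       (v\<^sup>2 * (1 - w * q) * (1 - w\<^sup>2 * q) / ((q - w * v\<^sup>2) * (q - w\<^sup>2 * v\<^sup>2)))"
proof -
  \<comment> \<open>Cancelling 1 - w q and 1 - w^2 q first keeps the polynomial identity left after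
    clearing denominators small.\<close>
  have "w * q * (1 - w)\<^sup>2 / ((1 - w * q) * (1 - w\<^sup>2 * q)) * ((1 - v\<^sup>2) / (1 - w * v\<^sup>2)) *
       (v\<^sup>2 * (1 - w * q) * (1 - w\<^sup>2 * q) / ((q - w * v\<^sup>2) * (q - w\<^sup>2 * v\<^sup>2)))
     = w * q * (1 - w)\<^sup>2 * (1 - v\<^sup>2) * v\<^sup>2 / ((1 - w * v\<^sup>2) * ((q - w * v\<^sup>2) * (q - w\<^sup>2 * v\<^sup>2)))"
    using assms by simp
  then show ?thesis
    using assms by (simp add: divide_simps) (simp add: algebra_simps power2_eq_square)
qed

context
  fixes q :: "'a::field"
  assumes q0: "q \<noteq> 0" and q1: "\<And>k. k > 0 \<Longrightarrow> q ^ k \<noteq> 1"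
begin

section \<open>Slater's Bailey pair and a truncated conjugate Bailey pair\<close>

lemma qpoch_nonzero: "qpoch q n \<noteq> 0"
  using q1 by (simp add: qpoch_def)

text \<open>This holds for every integer k: at k = 0 the factor 1 - q^k vanishes exactly where the
  left side drops to the default value 0.\<close>

lemma qinv_minus_1: "qinv q (k - 1) = (1 - q powi k) * qinv q k"
proof (cases "k \<le> 0")
  case False
  define m where "m = nat (k - 1)"
  have k: "k = int (Suc m)"
    using False by (simp add: m_def)
  have "q ^ Suc m \<noteq> 1"
    using q1 by blast
  then show ?thesis
    using qpoch_nonzero[of m] unfolding k qinv_def power_int_of_nat
        by (simp add: field_simps nat_add_distrib)
qed (auto simp: qinv_def)

lemma qinv_minus_2: "qinv q (k - 2) = (1 - q powi k / q) * (1 - q powi k) * qinv q k"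
proof -
  have "qinv q (k - 2) = (1 - q powi (k - 1)) * qinv q (k - 1)"
    using qinv_minus_1[of "k - 1"] by simp
  then show ?thesis
    using q0 by (simp add: qinv_minus_1[of k] power_int_diff)
qed

text \<open>The certificate \<open>G\<close> relies on the terms \<open>j\<close> and \<open>-j\<close> of the bilateral series being
  combined in \<^const>\<open>bailey_alpha\<close>; the term \<open>j = 0\<close> then contributes half of its difference.\<close>

lemma bailey_certificate:
  fixes n j :: nat
  assumes "j > 0"
  defines "G \<equiv> \<lambda>j::nat. - (q ^ n) * (- 1) ^ j * q ^ (3 * j * (j - 1)) *
    (qinv q (int n - 2 * int j) * qinv q (int n + 2 * int j - 2))"
  shows "bailey_alpha q j * (((1 - q ^ n) * (1 - q ^ n * q ^ n / q)) *
      (qinv q (int n - 2 * int j) * qinv q (int n + 2 * int j))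
    - qinv q (int n - 1 - 2 * int j) * qinv q (int n - 1 + 2 * int j)) = G (Suc j) - G j"
proof -
  \<comment> \<open>In these variables all powers of q become monomials and all shifted reciprocals
    become rational multiples of c and d, so the claim is one rational identity.\<close>
  define X where "X = q ^ j"
  define P where "P = q ^ (3 * j * j)"
  define Y where "Y = q ^ n"
  define s where "s = (- 1 :: 'a) ^ j"
  define c where "c = qinv q (int n - 2 * int j)"
  define d where "d = qinv q (int n + 2 * int j)"
  have nz: "X \<noteq> 0" "P \<noteq> 0" "Y \<noteq> 0"
    using q0 by (simp_all add: X_def P_def Y_def)
  have pw: "q powi (int n - 2 * int j) = Y / X\<^sup>2" "q powi (int n + 2 * int j) = Y * X\<^sup>2"
    using q0 by (simp_all add: power_int_diff power_int_add power_int_mult X_def Y_def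
      power_mult_distrib power_int_power' mult.commute flip: power_mult)
  have e1: "q ^ (j * (3 * j - 1)) = P / X" "q ^ (j * (3 * j + 1)) = P * X"
  proof -
    have "q ^ (j * (3 * j - 1)) * X = q ^ (j * (3 * j - 1) + j)"
      by (simp add: X_def power_add)
    also have "j * (3 * j - 1) + j = 3 * j * j"
      using assms by (simp add: algebra_simps diff_mult_distrib2)
    finally show "q ^ (j * (3 * j - 1)) = P / X"
      using nz by (simp add: P_def field_simps)
    show "q ^ (j * (3 * j + 1)) = P * X"
      by (simp add: P_def X_def algebra_simps flip: power_add)
  qed
  have e2: "q ^ (3 * j * (j - 1)) = P / X ^ 3" "q ^ (3 * Suc j * (Suc j - 1)) = P * X ^ 3"
  proof -
    have "q ^ (3 * j * (j - 1)) * X ^ 3 = q ^ (3 * j * (j - 1) + j * 3)"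
      by (simp add: X_def power_add power_mult)
    also have "3 * j * (j - 1) + j * 3 = 3 * j * j"
      using assms by (cases j) (simp_all add: algebra_simps)
    finally show "q ^ (3 * j * (j - 1)) = P / X ^ 3"
      using nz by (simp add: P_def field_simps)
    show "q ^ (3 * Suc j * (Suc j - 1)) = P * X ^ 3"
      by (simp add: P_def X_def algebra_simps flip: power_add power_mult)
  qed
  have c1: "qinv q (int n - 1 - 2 * int j) = (1 - Y / X\<^sup>2) * c"
    using qinv_minus_1[of "int n - 2 * int j"] unfolding pw c_def
        by (simp add: diff_diff_eq add.commute)
  have d1: "qinv q (int n - 1 + 2 * int j) = (1 - Y * X\<^sup>2) * d"
    using qinv_minus_1[of "int n + 2 * int j"] unfolding pw d_def by (simp add: diff_add_eq)
  have c2: "qinv q (int n - 2 * int (Suc j)) = (1 - Y / X\<^sup>2 / q) * (1 - Y / X\<^sup>2) * c"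
    using qinv_minus_2[of "int n - 2 * int j"] unfolding pw c_def
        by (simp add: diff_diff_eq add.commute)
  have d2: "qinv q (int n + 2 * int j - 2) = (1 - Y * X\<^sup>2 / q) * (1 - Y * X\<^sup>2) * d"
    using qinv_minus_2[of "int n + 2 * int j"] unfolding pw d_def .
  have d3: "qinv q (int n + 2 * int (Suc j) - 2) = d"
    by (simp add: d_def)
  show ?thesis
    unfolding G_def bailey_alpha_def e1 e2 c1 d1 c2 d2 d3 c_def[symmetric] d_def[symmetric]
      Y_def[symmetric] power_Suc s_def[symmetric]
    using nz q0 by (simp add: divide_simps) (simp add: algebra_simps eval_nat_numeral)
qed

text \<open>The recurrence in n obeyed by \<open>1 / (qpoch q n * qpoch_odd q n)\<close> is proved
  for the alpha sum by telescoping the certificate over j.\<close>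

lemma bailey_step:
  assumes "n < J"
  defines "S \<equiv> \<lambda>n. qinv q (int n) * qinv q (int n) +
    (\<Sum>j=1..J. bailey_alpha q j * (qinv q (int n - 2 * int j) * qinv q (int n + 2 * int j)))"
  shows "(1 - q ^ Suc n) * (1 - q ^ (2 * n + 1)) * S (Suc n) = S n"
proof -
  let ?N = "Suc n"
  define y where "y = q ^ ?N"
  define G where "G = (\<lambda>j::nat. - y * (- 1) ^ j * q ^ (3 * j * (j - 1)) *
    (qinv q (int ?N - 2 * int j) * qinv q (int ?N + 2 * int j - 2)))"
  have yy: "q ^ (2 * n + 1) = y * y / q"
    using q0 by (simp add: y_def mult_2 power_add)
  have "(1 - y) * (1 - y * y / q)
      * (\<Sum>j=1..J. bailey_alpha q j * (qinv q (int ?N - 2 * int j) * qinv q (int ?N + 2 * int j)))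
      - (\<Sum>j=1..J. bailey_alpha q j * (qinv q (int n - 2 * int j) * qinv q (int n + 2 * int j)))
      = (\<Sum>j=1..J. bailey_alpha q j * (((1 - y) * (1 - y * y / q)) *
      (qinv q (int ?N - 2 * int j) * qinv q (int ?N + 2 * int j))
    - qinv q (int ?N - 1 - 2 * int j) * qinv q (int ?N - 1 + 2 * int j)))"
    by (simp add: sum_distrib_left right_diff_distrib sum_subtractf mult_ac)
  also have "\<dots> = (\<Sum>j=1..J. G (Suc j) - G j)"
    unfolding G_def y_def by (intro sum.cong refl bailey_certificate) auto
  also have "\<dots> = G (Suc J) - G 1"
    using sum_Suc_diff[of 1 J G] assms by simp
  \<comment> \<open>The index \<open>Suc n - 2 * Suc J\<close> is negative because n < J.\<close>
  also have "G (Suc J) = 0"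
    using assms by (simp add: G_def qinv_def)
  \<comment> \<open>This boundary value cancels the change of the separate j = 0 term, since (1 - y)
    (1 - y^2/q) - (1 - y)^2 = y (1 - y) (1 - y/q).\<close>
  also have "G 1 = y * (qinv q (int ?N - 2) * qinv q (int ?N))"
    by (simp add: G_def)
  also have "qinv q (int ?N - 2) = (1 - y / q) * (1 - y) * qinv q (int ?N)"
    using qinv_minus_2[of "int ?N"] unfolding power_int_of_nat y_def .
  finally have *: "(1 - y) * (1 - y * y / q)
      * (\<Sum>j=1..J. bailey_alpha q j * (qinv q (int ?N - 2 * int j) * qinv q (int ?N + 2 * int j)))
      - (\<Sum>j=1..J. bailey_alpha q j * (qinv q (int n - 2 * int j) * qinv q (int n + 2 * int j)))
      = 0 - y * ((1 - y / q) * (1 - y) * qinv q (int ?N) * qinv q (int ?N))" .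
  have **: "qinv q (int n) = (1 - y) * qinv q (int ?N)"
    using qinv_minus_1[of "int ?N"] unfolding power_int_of_nat y_def by simp
  have "(1 - y) * (1 - y * y / q) * S ?N - S n = 0"
    using * unfolding S_def ** by (simp add: field_simps)
  then show ?thesis
    unfolding yy y_def[symmetric] by simp
qed

text \<open>Both sides satisfy the same first-order recurrence in n and agree at n = 0. The bound J
  is free because summands with 2 j > n vanish; this permits one common bound for many n.\<close>

lemma bailey_pair:
  assumes "n \<le> J"
  shows "1 / (qpoch q n * qpoch_odd q n) = qinv q (int n) * qinv q (int n) +
    (\<Sum>j=1..J. bailey_alpha q j * (qinv q (int n - 2 * int j) * qinv q (int n + 2 * int j)))"
  using assms
proof (induction n)
  case 0
  have "(\<Sum>j=1..J. bailey_alpha q j * (qinv q (int 0 - 2 * int j) * qinv q (int 0 + 2 * int j))) = 0"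
    by (intro sum.neutral) (auto simp: qinv_def)
  then show ?case by (simp add: qinv_def)
next
  case (Suc n)
  have nz: "1 - q ^ Suc n \<noteq> 0" "1 - q ^ (2 * n + 1) \<noteq> 0"
    using q1[of "Suc n"] q1[of "2 * n + 1"] by simp_all
  have "n < J" "n \<le> J"
    using Suc.prems by auto
  note IH = Suc.IH[OF \<open>n \<le> J\<close>] and step = bailey_step[OF \<open>n < J\<close>]
  have "1 / (qpoch q (Suc n) * qpoch_odd q (Suc n)) =
      1 / (qpoch q n * qpoch_odd q n) / ((1 - q ^ Suc n) * (1 - q ^ (2 * n + 1)))"
    by (simp add: mult_ac)
  also have "\<dots> = qinv q (int (Suc n)) * qinv q (int (Suc n)) +
    (\<Sum>j=1..J. bailey_alpha q j
        * (qinv q (int (Suc n) - 2 * int j) * qinv q (int (Suc n) + 2 * int j)))"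
    unfolding IH step[symmetric] using nz by simp
  finally show ?case .
qed

text \<open>The partial sums have a closed form, so induction on N suffices. At N = 0 both sides
  vanish because r > 0 makes the index -r negative.\<close>

lemma conjugate_bailey:
  assumes "r > 0"
  shows "(\<Sum>n=1..N. q ^ n * qpoch q (n - 1) ^ 2 * (qinv q (int n - int r) * qinv q (int n + int r)))
    = q ^ r / (1 - q ^ r) ^ 2 * qpoch q N ^ 2 * (qinv q (int N - int r) * qinv q (int N + int r))"
proof (induction N)
  case 0
  then show ?case using assms by (simp add: qinv_def)
next
  case (Suc N)
  define c where "c = qinv q (int (Suc N) - int r)"
  define d where "d = qinv q (int (Suc N) + int r)"
  define X where "X = q ^ r"
  define Y where "Y = q ^ Suc N"
  have nz: "X \<noteq> 0" "1 - X \<noteq> 0"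
    using q0 q1[of r] assms by (simp_all add: X_def)
  have c: "qinv q (int N - int r) = (1 - Y / X) * c"
    using qinv_minus_1[of "int (Suc N) - int r"] q0
    by (simp add: c_def X_def Y_def power_int_diff power_int_add)
  have d: "qinv q (int N + int r) = (1 - Y * X) * d"
    using qinv_minus_1[of "int (Suc N) + int r"] q0
    by (simp add: d_def X_def Y_def power_int_add algebra_simps)
  have "(\<Sum>n=1..Suc N. q ^ n * qpoch q (n - 1) ^ 2
      * (qinv q (int n - int r) * qinv q (int n + int r)))
    = X / (1 - X) ^ 2 * qpoch q N ^ 2 * (((1 - Y / X) * c) * ((1 - Y * X) * d))
      + Y * qpoch q N ^ 2 * (c * d)"
    by (simp add: Suc.IH[simplified] c_def[simplified] d_def[simplified] c[simplified] d X_def Y_def)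
  also have "\<dots> = X / (1 - X) ^ 2 * qpoch q N ^ 2 * (c * d)
      * ((1 - Y / X) * (1 - Y * X) + Y * (1 - X) ^ 2 / X)"
    using nz by (simp add: field_simps)
  \<comment> \<open>This identity turns the old closed form plus the new summand into the closed
    form for \<open>Suc N\<close>.\<close>
  also have "(1 - Y / X) * (1 - Y * X) + Y * (1 - X) ^ 2 / X = (1 - Y) ^ 2"
    using nz by (simp add: field_simps power2_eq_square)
  finally show ?case
    unfolding c_def d_def X_def Y_def by (simp add: power_mult_distrib mult_ac)
qed


section \<open>The finite q-Gauss sum, followed by the finite Bailey sum\<close>

lemma gauss_weight_eq_0: "N < n \<Longrightarrow> gauss_weight q N n = 0"
  by (auto simp: gauss_weight_def intro!: bexI[of _ N])

text \<open>Raising M by one shifts the numerator product by one factor and the denominator product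
  by two; the common factor 1 - q^(2 M + 2) cancels. The multiplied-out form also covers n =
  \<open>Suc M\<close>, where both sides are 0.\<close>

lemma gauss_weight_shift:
  assumes "n \<le> Suc M"
  shows "gauss_weight q M n * ((1 - q ^ (2 * Suc M - n)) * (1 - q ^ (2 * Suc M - n - 1)))
    = gauss_weight q (Suc M) n * ((1 - q ^ (2 * (Suc M - n))) * (1 - q ^ (2 * Suc M - 1)))"
  using assms
proof (induction n)
  case 0
  then show ?case by (simp add: gauss_weight_def)
next
  case (Suc n)
  show ?case
  proof (cases "n = M")
    case True
    then show ?thesis by (simp add: gauss_weight_eq_0)
  next
    case False
    then obtain k where M: "M = n + k" and k: "k > 0"
      using Suc.prems by (metis Suc_le_mono add_0_right le_Suc_ex zero_less_iff_neq_zero)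
    define x where "x = 1 - q ^ (n + 2 * k)"
    define y where "y = 1 - q ^ (n + 2 * k + 1)"
    define z where "z = 1 - q ^ (n + 2 * k + 2)"
    define u where "u = 1 - q ^ (2 * k)"
    define v where "v = 1 - q ^ (2 * k + 2)"
    define t where "t = 1 - q ^ (2 * n + 2 * k + 1)"
    have nz: "x \<noteq> 0" "y \<noteq> 0" "z \<noteq> 0"
      using k q1[of "n + 2 * k"] q1[of "n + 2 * k + 1"] q1[of "n + 2 * k + 2"]
          by (simp_all add: x_def y_def z_def)
    have 1: "2 * Suc M - n = n + 2 * k + 2" "2 * Suc M - n - 1 = n + 2 * k + 1"
      "2 * (Suc M - n) = 2 * k + 2" "2 * Suc M - 1 = 2 * n + 2 * k + 1"
      "2 * Suc M - Suc n = n + 2 * k + 1" "2 * Suc M - Suc n - 1 = n + 2 * k"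
      "2 * (Suc M - Suc n) = 2 * k" "2 * (M - n) = 2 * k" "2 * M - n = n + 2 * k"
      by (simp_all add: M)
    have eq: "gauss_weight q M n * (z * y) = gauss_weight q (Suc M) n * (v * t)"
      using Suc unfolding 1 x_def y_def z_def u_def v_def t_def by simp
    have g1: "gauss_weight q M (Suc n) = gauss_weight q M n * (u / x)"
      unfolding gauss_weight_def prod.lessThan_Suc 1 x_def u_def ..
    have g2: "gauss_weight q (Suc M) (Suc n) = gauss_weight q (Suc M) n * (v / z)"
      unfolding gauss_weight_def prod.lessThan_Suc 1 v_def z_def ..
    have "gauss_weight q M (Suc n) * (y * x) = gauss_weight q M n * (z * y) * (u / z)"
      "gauss_weight q (Suc M) (Suc n) * (u * t) = gauss_weight q (Suc M) n * (v * t) * (u / z)"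
      unfolding g1 g2 using nz by simp_all
    with eq show ?thesis
      unfolding 1 add_diff_cancel_right' x_def y_def u_def t_def by simp
  qed
qed

text \<open>A Wilf-Zeilberger pair: the change of the term in N is a difference in n. Dividing by
  the term for \<open>Suc M\<close> reduces it to \<open>gauss_certificate_identity\<close>.\<close>

lemma gauss_certificate:
  assumes "n > 0" "n \<le> Suc M"
  defines "G \<equiv> \<lambda>n. - gauss_term q (Suc M) n * (q ^ (2 * (Suc M - n)) * (1 - q ^ n) * (q - (q ^ n)\<^sup>2)
    / ((1 - q ^ (2 * Suc M - n)) * (q - q ^ (2 * Suc M))))"
  shows "gauss_term q (Suc M) n - gauss_term q M n = G (Suc n) - G n"
proof -
  obtain k where N: "Suc M = n + k"
    using assms(2) le_Suc_ex by blast
  define w where "w = q ^ n"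
  define v where "v = q ^ k"
  define A where "A = gauss_term q (Suc M) n"
  define h where "h = gauss_weight q (Suc M) n"
  have nat: "2 * (Suc M - n) = 2 * k" "2 * Suc M - n = n + 2 * k" "2 * Suc M = 2 * n + 2 * k"
    by (simp_all add: N)
  have pw: "q ^ (2 * (Suc M - n)) = v\<^sup>2" "q ^ (2 * Suc M - n) = w * v\<^sup>2"
    "q ^ (2 * Suc M) = w\<^sup>2 * v\<^sup>2"
    unfolding nat by (simp_all add: w_def v_def power_add power_mult power_mult_distrib
        mult.commute[of 2])
  have nz: "w \<noteq> 0" "1 - w \<noteq> 0" "1 - w * q \<noteq> 0" "1 - w\<^sup>2 * q \<noteq> 0" "1 - w * v\<^sup>2 \<noteq> 0"
    "q - w\<^sup>2 * v\<^sup>2 \<noteq> 0"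
  proof -
    have "w\<^sup>2 * v\<^sup>2 = q * q ^ (2 * M + 1)"
      unfolding pw(3)[symmetric] by simp
    then show "q - w\<^sup>2 * v\<^sup>2 \<noteq> 0"
      using q0 q1[of "2 * M + 1"] by simp
    show "w \<noteq> 0" "1 - w \<noteq> 0"
      using q0 q1[of n] assms(1) by (simp_all add: w_def)
    show "1 - w * q \<noteq> 0" "1 - w\<^sup>2 * q \<noteq> 0"
      using q1[of "n + 1"] q1[of "2 * n + 1"] by (simp_all add: w_def mult.commute power_mult)
    show "1 - w * v\<^sup>2 \<noteq> 0"
      using q1[of "n + 2 * k"] assms(1) unfolding pw(2)[symmetric] nat by simp
  qed
  have Gn: "G n = - A * (v\<^sup>2 * (1 - w) * (q - w\<^sup>2) / ((1 - w * v\<^sup>2) * (q - w\<^sup>2 * v\<^sup>2)))"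
    unfolding G_def pw A_def[symmetric] w_def[symmetric] ..
  show ?thesis
  proof (cases "k = 0")
    \<comment> \<open>For n = \<open>Suc M\<close> the denominator q - w v^2 equals q - q^n and is 0
      when n = 1, so this end is checked directly; the vanishing weights leave only -G n on the
      right.\<close>
    case True
    then have n: "n = Suc M" "v = 1"
      by (simp_all add: N v_def)
    have "gauss_term q M n = 0" "G (Suc n) = 0"
      using n by (simp_all add: gauss_term_def gauss_weight_eq_0 G_def)
    moreover have "q - w\<^sup>2 \<noteq> 0"
      using nz n by simp
    ultimately show ?thesis
      using nz unfolding Gn n(2) by (simp add: A_def)
  next
    case False
    have nz': "q - w * v\<^sup>2 \<noteq> 0"
    proof -
      have "q ^ (n + 2 * k) = q * q ^ (n + 2 * k - 1)"
        using False by (simp flip: power_Suc)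
      then have "w * v\<^sup>2 = q * q ^ (n + 2 * k - 1)"
        using pw(2) nat(2) by simp
      then show ?thesis
        using q0 q1[of "n + 2 * k - 1"] False by simp
    qed
    have shift: "gauss_weight q M n * ((1 - w * v\<^sup>2) * (1 - w * v\<^sup>2 / q))
        = h * ((1 - v\<^sup>2) * (1 - w\<^sup>2 * v\<^sup>2 / q))"
    proof -
      have "q ^ (2 * Suc M - n - 1) = w * v\<^sup>2 / q" "q ^ (2 * Suc M - 1) = w\<^sup>2 * v\<^sup>2 / q"
        using q0 False unfolding pw(2,3)[symmetric] nat by (simp_all add: power_diff)
      then show ?thesis
        using gauss_weight_shift[OF assms(2)] unfolding pw h_def by simp
    qed
    have "gauss_weight q M n = h * ((1 - v\<^sup>2) * (q - w\<^sup>2 * v\<^sup>2) / ((1 - w * v\<^sup>2) * (q - w * v\<^sup>2)))"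
    proof -
      have "1 - w * v\<^sup>2 / q = (q - w * v\<^sup>2) / q" "1 - w\<^sup>2 * v\<^sup>2 / q = (q - w\<^sup>2 * v\<^sup>2) / q"
        using q0 by (simp_all add: diff_divide_distrib)
      then have "gauss_weight q M n * ((1 - w * v\<^sup>2) * (q - w * v\<^sup>2))
          = h * ((1 - v\<^sup>2) * (q - w\<^sup>2 * v\<^sup>2))"
        using shift q0 by simp
      then show ?thesis
        using nz nz' by (simp add: eq_divide_eq)
    qed
    then have AM: "gauss_term q M n
        = A * ((1 - v\<^sup>2) * (q - w\<^sup>2 * v\<^sup>2) / ((1 - w * v\<^sup>2) * (q - w * v\<^sup>2)))"
      by (simp add: gauss_term_def A_def h_def)
    have AS: "gauss_term q (Suc M) (Suc n)
        = A * (w * q * (1 - w)\<^sup>2 / ((1 - w * q) * (1 - w\<^sup>2 * q)) * ((1 - v\<^sup>2) / (1 - w * v\<^sup>2)))"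
    proof -
      obtain l where l: "n = Suc l"
        using assms(1) gr0_conv_Suc by blast
      have 1: "q ^ (Suc n * (Suc n + 1) div 2) = q ^ (n * (n + 1) div 2) * (w * q)"
      proof -
        have "Suc n * (Suc n + 1) div 2 = n * (n + 1) div 2 + (n + 1)"
          by simp
        then show ?thesis by (simp only: power_add w_def power_one_right)
      qed
      have 2: "qpoch q (Suc n - 1) = qpoch q (n - 1) * (1 - w)"
        by (simp add: l w_def)
      have 3: "qpoch q (Suc n) = qpoch q n * (1 - w * q)"
        "qpoch_odd q (Suc n) = qpoch_odd q n * (1 - w\<^sup>2 * q)"
        by (simp_all add: w_def mult.commute power_mult)
      have 4: "gauss_weight q (Suc M) (Suc n) = h * ((1 - v\<^sup>2) / (1 - w * v\<^sup>2))"
        unfolding gauss_weight_def prod.lessThan_Suc pw h_def ..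
      show ?thesis
        unfolding gauss_term_def A_def 1 2 3 4 h_def[symmetric]
            by (simp add: power_mult_distrib mult_ac)
    qed
    have GS: "G (Suc n) = - gauss_term q (Suc M) (Suc n) *
        (v\<^sup>2 * (1 - w * q) * (1 - w\<^sup>2 * q) / ((q - w * v\<^sup>2) * (q - w\<^sup>2 * v\<^sup>2)))"
    proof -
      obtain l where l: "k = Suc l"
        using False by (cases k) auto
      have "2 * (Suc M - Suc n) = 2 * l" "2 * Suc M - Suc n = n + 2 * l + 1"
        by (simp_all add: N l)
      then have "q ^ (2 * (Suc M - Suc n)) = v\<^sup>2 / q\<^sup>2" "q ^ (2 * Suc M - Suc n) = w * v\<^sup>2 / q"
        using q0 by (simp_all only:) (simp_all add: v_def w_def l power_add power_mult power_mult_distrib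
          mult.commute[of 2] power2_eq_square)
      moreover have "q ^ Suc n = w * q"
        by (simp add: w_def)
      moreover have "q - (w * q)\<^sup>2 = q * (1 - w\<^sup>2 * q)" "1 - w * v\<^sup>2 / q = (q - w * v\<^sup>2) / q"
        using q0 by (simp_all add: right_diff_distrib diff_divide_distrib power2_eq_square mult_ac)
      ultimately have "G (Suc n) = - gauss_term q (Suc M) (Suc n)
          * (v\<^sup>2 / q\<^sup>2 * (1 - w * q) * (q * (1 - w\<^sup>2 * q))
          / ((q - w * v\<^sup>2) / q * (q - w\<^sup>2 * v\<^sup>2)))"
        by (simp only: G_def pw)
      then show ?thesis
        using q0 nz nz' by (simp add: power2_eq_square[of q])
    qed
    have "A - gauss_term q M n = A
        * (1 - (1 - v\<^sup>2) * (q - w\<^sup>2 * v\<^sup>2) / ((1 - w * v\<^sup>2) * (q - w * v\<^sup>2)))"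
      by (simp add: AM right_diff_distrib)
    also have "\<dots> = G (Suc n) - G n"
      unfolding gauss_certificate_identity[OF nz(1) q0 nz(5) nz' nz(6,3,4)] GS Gn AS
      by (simp only: right_diff_distrib minus_mult_left[symmetric]
          mult.assoc diff_minus_eq_add) simp
    finally show ?thesis
      by (simp add: A_def)
  qed
qed

text \<open>Induction on N: summing the certificate over n shows that raising N adds -G 1, which is
  the next Lambert summand; the upper end vanishes with the weight.\<close>

lemma finite_gauss_second:
  "(\<Sum>n=1..N. gauss_term q N n) = (\<Sum>k=1..N. q ^ (2 * k - 1) / (1 - q ^ (2 * k - 1))\<^sup>2)"
proof (induction N)
  case 0
  then show ?case by simp
next
  case (Suc M)
  define G where "G = (\<lambda>n. - gauss_term q (Suc M) n
      * (q ^ (2 * (Suc M - n)) * (1 - q ^ n) * (q - (q ^ n)\<^sup>2)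
    / ((1 - q ^ (2 * Suc M - n)) * (q - q ^ (2 * Suc M)))))"
  have "(\<Sum>n=1..Suc M. gauss_term q (Suc M) n) - (\<Sum>n=1..Suc M. gauss_term q M n)
      = (\<Sum>n=1..Suc M. G (Suc n) - G n)"
    unfolding sum_subtractf[symmetric] G_def by (intro sum.cong refl gauss_certificate) auto
  also have "\<dots> = G (Suc (Suc M)) - G 1"
    using sum_Suc_diff[of 1 "Suc M" G] by simp
  also have "G (Suc (Suc M)) = 0"
    by (simp add: G_def gauss_term_def gauss_weight_eq_0)
  also have "G 1 = - (q ^ (2 * Suc M - 1) / (1 - q ^ (2 * Suc M - 1))\<^sup>2)"
  proof -
    have "gauss_weight q (Suc M) 1 = 1"
      using q1[of "2 * Suc M"] by (simp add: gauss_weight_def)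
    then have "gauss_term q (Suc M) 1 = q / (1 - q)\<^sup>2"
      by (simp add: gauss_term_def qpoch_def qpoch_odd_def power2_eq_square)
    moreover define Q where "Q = q ^ (2 * M + 1)"
    have "q ^ (2 * (Suc M - 1)) = Q / q" "q ^ (2 * Suc M - 1) = Q" "q ^ (2 * Suc M) = q * Q"
      using q0 by (simp_all add: Q_def)
    moreover have "1 - q \<noteq> 0" "1 - Q \<noteq> 0"
      using q1[of 1] q1[of "2 * M + 1"] by (simp_all add: Q_def)
    moreover have "q - q * Q = q * (1 - Q)" "q - (q ^ 1)\<^sup>2 = q * (1 - q)"
      by (simp_all add: algebra_simps power2_eq_square)
    ultimately show ?thesis
      using q0 unfolding G_def by (simp add: power2_eq_square)
  qed
  \<comment> \<open>The extra summand n = \<open>Suc M\<close> carries the weight 0.\<close>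
  also have "(\<Sum>n=1..Suc M. gauss_term q M n) = (\<Sum>n=1..M. gauss_term q M n)"
    by (simp add: gauss_term_def gauss_weight_eq_0)
  finally show ?case
    using Suc.IH by (simp add: algebra_simps)
qed

text \<open>The Bailey lemma in finite form: expand by \<open>bailey_pair\<close>, exchange the sums
  over n and j, and evaluate the inner sums by \<open>conjugate_bailey\<close> with r = 2 j.\<close>

lemma bailey_sum:
  "(\<Sum>n=1..N. q ^ n * (qpoch q (n - 1) ^ 2 / (qpoch q n * qpoch_odd q n))) =
    (\<Sum>n=1..N. q ^ n / (1 - q ^ n) ^ 2) +
    (\<Sum>j=1..N div 2. bailey_alpha q j * (q ^ (2 * j) / (1 - q ^ (2 * j)) ^ 2) *
      (qpoch q N ^ 2 / (qpoch q (N - 2 * j) * qpoch q (N + 2 * j))))"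
proof -
  define w where "w = (\<lambda>n. q ^ n * qpoch q (n - 1) ^ 2)"
  define B where "B = (\<lambda>r n. qinv q (int n - int r) * qinv q (int n + int r))"
  have "(\<Sum>n=1..N. q ^ n * (qpoch q (n - 1) ^ 2 / (qpoch q n * qpoch_odd q n)))
    = (\<Sum>n=1..N. w n * (qinv q (int n) * qinv q (int n))
        + (\<Sum>j=1..N. bailey_alpha q j * (w n * B (2 * j) n)))"
  \<comment> \<open>The pair is expanded with J = N for every n, so that the range of j is
    independent of n and the sums can be exchanged.\<close>
  proof (intro sum.cong refl)
    fix n assume "n \<in> {1..N}"
    then have "n \<le> N" by simp
    have "q ^ n * (qpoch q (n - 1) ^ 2 / (qpoch q n * qpoch_odd q n))
        = w n * (1 / (qpoch q n * qpoch_odd q n))"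
      by (simp add: w_def)
    then show "q ^ n * (qpoch q (n - 1) ^ 2 / (qpoch q n * qpoch_odd q n)) =
        w n * (qinv q (int n) * qinv q (int n)) + (\<Sum>j=1..N. bailey_alpha q j * (w n * B (2 * j) n))"
      unfolding bailey_pair[OF \<open>n \<le> N\<close>] B_def by (simp add: algebra_simps sum_distrib_left)
  qed
  also have "\<dots> = (\<Sum>n=1..N. w n * (qinv q (int n) * qinv q (int n)))
      + (\<Sum>j=1..N. bailey_alpha q j * (\<Sum>n=1..N. w n * B (2 * j) n))"
    unfolding sum.distrib sum_distrib_left by (subst (2) sum.swap) simp
  \<comment> \<open>The index-0 part, outside the range r > 0 of \<open>conjugate_bailey\<close>,
    yields the Lambert series at once.\<close>
  also have "(\<Sum>n=1..N. w n * (qinv q (int n) * qinv q (int n)))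
      = (\<Sum>n=1..N. q ^ n / (1 - q ^ n) ^ 2)"
  proof (intro sum.cong refl)
    fix n assume "n \<in> {1..N}"
    then obtain l where l: "n = Suc l" by (cases n) auto
    show "w n * (qinv q (int n) * qinv q (int n)) = q ^ n / (1 - q ^ n) ^ 2"
      using qpoch_nonzero[of l] unfolding w_def qinv_def l
          by (simp add: power2_eq_square nat_add_distrib)
  qed
  also have "(\<Sum>j=1..N. bailey_alpha q j * (\<Sum>n=1..N. w n * B (2 * j) n)) =
    (\<Sum>j=1..N. bailey_alpha q j
        * (q ^ (2 * j) / (1 - q ^ (2 * j)) ^ 2 * qpoch q N ^ 2 * B (2 * j) N))"
    unfolding w_def B_def by (intro sum.cong refl arg_cong2[where f = "(*)"] conjugate_bailey) auto
  also have "\<dots> = (\<Sum>j=1..N div 2. bailey_alpha q j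
      * (q ^ (2 * j) / (1 - q ^ (2 * j)) ^ 2 * qpoch q N ^ 2 * B (2 * j) N))"
    by (intro sum.mono_neutral_right) (auto simp: B_def qinv_def)
  also have "\<dots> = (\<Sum>j=1..N div 2. bailey_alpha q j * (q ^ (2 * j) / (1 - q ^ (2 * j)) ^ 2) *
      (qpoch q N ^ 2 / (qpoch q (N - 2 * j) * qpoch q (N + 2 * j))))"
    by (intro sum.cong refl) (auto simp: B_def qinv_def nat_diff_distrib nat_add_distrib
      nat_mult_distrib mult_ac simp flip: of_nat_diff)
  finally show ?thesis .
qed

end

section \<open>Generating functions of partitions by smallest part\<close>

definition geo :: "nat \<Rightarrow> real fps" where
  "geo k = inverse (1 - fps_X ^ k)"

lemma geo_mult: "k > 0 \<Longrightarrow> (1 - fps_X ^ k) * geo k = 1"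
  unfolding geo_def by (rule inverse_mult_eq_1') simp

lemma finite_partitions_from:
  fixes S :: "nat set"
  assumes "0 \<notin> S"
  shows "finite {\<pi>. set_mset \<pi> \<subseteq> S \<and> sum_mset \<pi> = m}"
  by (rule finite_subset[OF _ finite_partitions_le[of m]]) (use assms in \<open>auto simp: is_partition_def\<close>)

text \<open>Either k does not occur, or one copy of it can be removed. A general f serves both plain
  counting and counting weighted by multiplicity.\<close>

lemma sum_partitions_insert:
  fixes f :: "nat multiset \<Rightarrow> 'a::comm_monoid_add"
  assumes "k \<notin> S" "0 \<notin> insert k S"
  shows "(\<Sum>\<pi> | set_mset \<pi> \<subseteq> insert k S \<and> sum_mset \<pi> = m. f \<pi>) =
    (\<Sum>\<pi> | set_mset \<pi> \<subseteq> S \<and> sum_mset \<pi> = m. f \<pi>) +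
    (if m < k then 0 else (\<Sum>\<pi> | set_mset \<pi> \<subseteq> insert k S \<and> sum_mset \<pi> = m - k. f (add_mset k \<pi>)))"
proof -
  define P where "P = (\<lambda>S m. {\<pi>::nat multiset. set_mset \<pi> \<subseteq> S \<and> sum_mset \<pi> = m})"
  have fin: "finite (P T n)" if "T \<subseteq> insert k S" for T n
    unfolding P_def using that assms by (intro finite_partitions_from) auto
  define Q where "Q = {\<pi> \<in> P (insert k S) m. k \<in># \<pi>}"
  have "P (insert k S) m = P S m \<union> Q"
    unfolding P_def Q_def by auto
  moreover have "P S m \<inter> Q = {}"
    using assms unfolding P_def Q_def by auto
  moreover have "finite Q"
    using fin by (simp add: Q_def)
  ultimately have "sum f (P (insert k S) m) = sum f (P S m) + sum f Q"
    using fin by (simp add: sum.union_disjoint subset_insertI)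
  also have "sum f Q = (if m < k then 0 else (\<Sum>\<pi>\<in>P (insert k S) (m - k). f (add_mset k \<pi>)))"
  proof (cases "m < k")
    case True
    have "Q = {}"
      using True unfolding Q_def P_def by (auto dest!: multi_member_split)
    then show ?thesis using True by simp
  next
    case False
    have "Q = add_mset k ` P (insert k S) (m - k)"
    proof
      show "Q \<subseteq> add_mset k ` P (insert k S) (m - k)"
        unfolding Q_def P_def by (auto dest!: multi_member_split)
      show "add_mset k ` P (insert k S) (m - k) \<subseteq> Q"
        using False unfolding Q_def P_def by auto
    qed
    then show ?thesis
      using False by (simp add: sum.reindex inj_on_def)
  qed
  finally show ?thesis
    unfolding P_def .
qed

definition partition_gf :: "nat set \<Rightarrow> real fps" where
  "partition_gf S = Abs_fps (\<lambda>m. \<Sum>\<pi> | set_mset \<pi> \<subseteq> S \<and> sum_mset \<pi> = m. 1)"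

definition count_gf :: "nat \<Rightarrow> nat set \<Rightarrow> real fps" where
  "count_gf s S = Abs_fps (\<lambda>m. \<Sum>\<pi> | set_mset \<pi> \<subseteq> insert s S \<and> sum_mset \<pi> = m. of_nat (count \<pi> s))"

lemma partition_gf_insert:
  assumes "k \<notin> S" "0 \<notin> insert k S"
  shows "(1 - fps_X ^ k) * partition_gf (insert k S) = partition_gf S"
proof -
  have "partition_gf (insert k S) = partition_gf S + fps_X ^ k * partition_gf (insert k S)"
    by (rule fps_ext) (simp only: partition_gf_def fps_nth_Abs_fps fps_add_nth fps_X_power_mult_nth,
        rule sum_partitions_insert[OF assms])
  then show ?thesis
    by (simp add: algebra_simps)
qed

lemma partition_gf_prod:
  assumes "finite S" "0 \<notin> S"
  shows "(\<Prod>k\<in>S. 1 - fps_X ^ k) * partition_gf S = 1"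
  using assms
proof (induction S)
  case empty
  have "{\<pi>::nat multiset. \<pi> = {#} \<and> sum_mset \<pi> = m} = (if m = 0 then {{#}} else {})" for m
    by auto
  then show ?case
    by (simp add: partition_gf_def fps_eq_iff)
next
  case (insert k S)
  have "(\<Prod>k\<in>insert k S. 1 - fps_X ^ k) * partition_gf (insert k S)
    = (\<Prod>k\<in>S. 1 - fps_X ^ k) * ((1 - fps_X ^ k) * partition_gf (insert k S))"
    using insert by (simp add: mult_ac)
  also have "\<dots> = 1"
    using insert by (simp add: partition_gf_insert)
  finally show ?case .
qed

text \<open>Adding a copy of s raises its multiplicity by one, so \<open>count_gf s S\<close>
  reproduces itself plus a plain partition series. Solving costs one factor 1 - X^s, and freeing
  that partition series of the part s costs the other.\<close>

lemma count_gf_eq: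
  assumes "s \<notin> S" "0 \<notin> insert s S"
  shows "(1 - fps_X ^ s) ^ 2 * count_gf s S = fps_X ^ s * partition_gf S"
proof -
  have "count_gf s S = fps_X ^ s * (count_gf s S + partition_gf (insert s S))"
  proof (rule fps_ext)
    fix m
    have "(\<Sum>\<pi> | set_mset \<pi> \<subseteq> S \<and> sum_mset \<pi> = m. real (count \<pi> s)) = 0"
      using assms by (intro sum.neutral) (auto simp: count_eq_zero_iff)
    then show "count_gf s S $ m = (fps_X ^ s * (count_gf s S + partition_gf (insert s S))) $ m"
      using sum_partitions_insert[OF assms, where f = "\<lambda>\<pi>. real (count \<pi> s)" and m = m]
      by (simp add: fps_X_power_mult_nth count_gf_def partition_gf_def sum.distrib)
  qed
  then have "(1 - fps_X ^ s) * count_gf s S = fps_X ^ s * partition_gf (insert s S)"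
    by (simp add: algebra_simps)
  then have "(1 - fps_X ^ s) ^ 2 * count_gf s S
      = fps_X ^ s * ((1 - fps_X ^ s) * partition_gf (insert s S))"
    by (simp add: power2_eq_square mult_ac)
  then show ?thesis
    by (simp add: partition_gf_insert[OF assms])
qed

text \<open>The bound \<open>2 * K\<close> only truncates the infinite supply of even parts.\<close>

definition larger_parts :: "nat \<Rightarrow> nat \<Rightarrow> nat set" where
  "larger_parts K s = {p. s < p \<and> p \<le> 2 * K \<and> (odd p \<longrightarrow> p \<le> 2 * s)}"

section \<open>Admissible partitions sorted by their smallest part\<close>

lemma smallest_part_eqI: "s \<in># \<pi> \<Longrightarrow> (\<And>p. p \<in># \<pi> \<Longrightarrow> s \<le> p) \<Longrightarrow> smallest_part \<pi> = s"
  unfolding smallest_part_def by (intro Min_eqI) auto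

lemma smallest_part_in: "admissible \<pi> \<Longrightarrow> smallest_part \<pi> \<in># \<pi>"
  unfolding smallest_part_def admissible_def by (intro Min_in) auto

text \<open>The exponent e treats both counting functions at once: 0 for the plus version, s choose
  2 for the minus version. The bound m in \<open>larger_parts\<close> loses nothing, as no part
  exceeds m.\<close>

lemma sum_count_smallest_part:
  "of_nat (\<Sum>\<pi> | admissible \<pi> \<and> sum_mset \<pi> + e (smallest_part \<pi>) = m. count \<pi> (smallest_part \<pi>))
    = (\<Sum>s=1..m. fps_X ^ e s * count_gf s (larger_parts m s)) $ m"
proof -
  define I where "I = {\<pi>. admissible \<pi> \<and> sum_mset \<pi> + e (smallest_part \<pi>) = m}"
  have finI: "finite I"
    by (rule finite_subset[OF _ finite_partitions_le[of m]]) (auto simp: I_def admissible_def)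
  have le: "p \<le> sum_mset \<pi>" if "p \<in># \<pi>" for p and \<pi> :: "nat multiset"
    using that by (auto dest!: multi_member_split)
  have range: "smallest_part ` I \<subseteq> {1..m}"
  proof clarify
    fix \<pi> assume "\<pi> \<in> I"
    then have "smallest_part \<pi> \<in># \<pi>" "0 \<notin># \<pi>" "sum_mset \<pi> \<le> m"
      using smallest_part_in by (auto simp: I_def admissible_def is_partition_def)
    then show "smallest_part \<pi> \<in> {1..m}"
      using le[of "smallest_part \<pi>" \<pi>] by (cases "smallest_part \<pi>") auto
  qed
  have "real (\<Sum>\<pi>\<in>I. count \<pi> (smallest_part \<pi>))
      = (\<Sum>s=1..m. \<Sum>\<pi> | \<pi> \<in> I \<and> smallest_part \<pi> = s. real (count \<pi> (smallest_part \<pi>)))"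
    using sum.group[OF finI _ range, of "\<lambda>\<pi>. real (count \<pi> (smallest_part \<pi>))"] by simp
  also have "\<dots> = (\<Sum>s=1..m. (fps_X ^ e s * count_gf s (larger_parts m s)) $ m)"
  proof (intro sum.cong refl)
    fix s assume s: "s \<in> {1..m}"
    have "(\<Sum>\<pi> | \<pi> \<in> I \<and> smallest_part \<pi> = s. real (count \<pi> (smallest_part \<pi>))) =
      (\<Sum>\<pi> | \<pi> \<in> I \<and> smallest_part \<pi> = s. real (count \<pi> s))"
      by (intro sum.cong) auto
    also have "\<dots> = (if m < e s then 0 else
      (\<Sum>\<pi> | set_mset \<pi> \<subseteq> insert s (larger_parts m s) \<and> sum_mset \<pi> = m - e s. real (count \<pi> s)))"
    proof (cases "m < e s")
      case True
      then have "{\<pi> \<in> I. smallest_part \<pi> = s} = {}"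
        by (auto simp: I_def)
      then show ?thesis using True by (simp only: sum.empty if_True)
    next
      case False
      have "(\<Sum>\<pi> | \<pi> \<in> I \<and> smallest_part \<pi> = s. real (count \<pi> s)) =
        (\<Sum>\<pi> | set_mset \<pi> \<subseteq> insert s (larger_parts m s) \<and> sum_mset \<pi> = m - e s. real (count \<pi> s))"
      \<comment> \<open>The right index set also contains multisets without the part s, but these
        have multiplicity 0; any member containing s has s as its smallest part and is
        admissible.\<close>
      proof (rule sum.mono_neutral_left)
        show "finite {\<pi>. set_mset \<pi> \<subseteq> insert s (larger_parts m s) \<and> sum_mset \<pi> = m - e s}"
          using s by (intro finite_partitions_from) (auto simp: larger_parts_def)
        show "{\<pi> \<in> I. smallest_part \<pi> = s}
            \<subseteq> {\<pi>. set_mset \<pi> \<subseteq> insert s (larger_parts m s) \<and> sum_mset \<pi> = m - e s}"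
        proof clarify
          fix \<pi> assume \<pi>: "\<pi> \<in> I" "s = smallest_part \<pi>"
          have "p \<in> insert s (larger_parts m s)" if "p \<in># \<pi>" for p
          proof -
            have "s \<le> p"
              using that by (simp add: \<pi>(2) smallest_part_def)
            moreover have "p \<le> m"
              using le[OF that] \<pi>(1) by (simp add: I_def)
            ultimately show ?thesis
              using \<pi> that by (auto simp: larger_parts_def I_def admissible_def not_less)
          qed
          then show "set_mset \<pi> \<subseteq> insert (smallest_part \<pi>) (larger_parts m (smallest_part \<pi>))
              \<and> sum_mset \<pi> = m - e (smallest_part \<pi>)"
            using \<pi> by (auto simp: I_def)
        qed
        show "\<forall>\<pi>\<in>{\<pi>. set_mset \<pi> \<subseteq> insert s (larger_parts m s) \<and> sum_mset \<pi> = m - e s}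
            - {\<pi> \<in> I. smallest_part \<pi> = s}. real (count \<pi> s) = 0"
        proof (rule ballI, rule ccontr)
          fix \<pi> assume \<pi>: "\<pi> \<in> {\<pi>. set_mset \<pi> \<subseteq> insert s (larger_parts m s) \<and> sum_mset \<pi> = m - e s}
              - {\<pi> \<in> I. smallest_part \<pi> = s}"
            and "real (count \<pi> s) \<noteq> 0"
          then have "s \<in># \<pi>"
            by (simp add: count_eq_zero_iff)
          moreover have parts: "p \<in> insert s (larger_parts m s)" if "p \<in># \<pi>" for p
            using \<pi> that by auto
          ultimately have sp: "smallest_part \<pi> = s"
            by (intro smallest_part_eqI) (auto simp: larger_parts_def dest!: parts)
          have "admissible \<pi>"
            unfolding admissible_def is_partition_def sp
            using parts s \<open>s \<in># \<pi>\<close> by (fastforce simp: larger_parts_def)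
          then show False
            using \<pi> False sp by (auto simp: I_def)
        qed
      qed
      then show ?thesis using False by simp
    qed
    finally show "(\<Sum>\<pi> | \<pi> \<in> I \<and> smallest_part \<pi> = s. real (count \<pi> (smallest_part \<pi>))) =
      (fps_X ^ e s * count_gf s (larger_parts m s)) $ m"
      by (simp add: fps_X_power_mult_nth count_gf_def)
  qed
  finally show ?thesis
    by (simp add: I_def fps_sum_nth)
qed

lemma spt_o_plus_gf:
  "of_nat (spt_o_plus m) = (\<Sum>s=1..m. count_gf s (larger_parts m s)) $ m"
  using sum_count_smallest_part[of "\<lambda>_. 0" m] by (simp add: spt_o_plus_def)

lemma spt_o_minus_gf:
  "of_nat (spt_o_minus m) = (\<Sum>s=1..m. fps_X ^ (s choose 2) * count_gf s (larger_parts m s)) $ m"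
proof -
  \<comment> \<open>The staircase is determined by \<pi>, so the pairs reindex by their first
    component.\<close>
  have "{(\<pi>, \<delta>). admissible \<pi> \<and> \<delta> = staircase (smallest_part \<pi>)
      \<and> sum_mset \<pi> + (smallest_part \<pi> choose 2) = m}
    = (\<lambda>\<pi>. (\<pi>, staircase (smallest_part \<pi>))) `
      {\<pi>. admissible \<pi> \<and> sum_mset \<pi> + (smallest_part \<pi> choose 2) = m}"
    by auto
  then have "spt_o_minus m = (\<Sum>\<pi> | admissible \<pi> \<and> sum_mset \<pi> + (smallest_part \<pi> choose 2) = m.
      count \<pi> (smallest_part \<pi>))"
    by (simp add: spt_o_minus_def sum.reindex inj_on_def)
  then show ?thesis
    using sum_count_smallest_part[of "\<lambda>s. s choose 2" m] by simp
qed

section \<open>Odd coefficients\<close>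

definition spt_coeff :: "nat \<Rightarrow> real fps" where
  "spt_coeff n = qpoch fps_X (n - 1) ^ 2 * inverse (qpoch fps_X n * qpoch_odd fps_X n)"

lemma qpoch_nth_0 [simp]: "qpoch (fps_X :: real fps) n $ 0 = 1"
  by (induction n) simp_all

lemma qpoch_odd_nth_0 [simp]: "qpoch_odd (fps_X :: real fps) n $ 0 = 1"
  by (induction n) simp_all

lemma spt_coeff_mult:
  "(qpoch fps_X n * qpoch_odd fps_X n) * spt_coeff n = qpoch fps_X (n - 1) ^ 2"
proof -
  have "(qpoch fps_X n * qpoch_odd fps_X n)
      * inverse (qpoch fps_X n * qpoch_odd fps_X n :: real fps) = 1"
    by (rule inverse_mult_eq_1') simp
  then show ?thesis
    by (simp add: spt_coeff_def mult_ac)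
qed

definition even_prod :: "nat \<Rightarrow> real fps" where
  "even_prod K = (\<Prod>k=1..K. 1 - fps_X ^ (2 * k))"

lemma qpoch_double: "qpoch fps_X (2 * n) = qpoch_odd fps_X n * even_prod n"
  by (induction n) (simp_all add: even_prod_def algebra_simps)

text \<open>The larger parts are all numbers in (s, 2s] and the even numbers 2k with s < k \<le> K.
  The first block gives (q;q)_{2s} / (q;q)_s, which splits into odd and even factors, and the second
  block completes the even ones.\<close>

lemma larger_parts_prod:
  assumes "s \<le> K"
  shows "(\<Prod>k\<in>larger_parts K s. 1 - fps_X ^ k :: real fps) * qpoch fps_X s
      = qpoch_odd fps_X s * even_prod K"
proof -
  have "larger_parts K s = {s<..2 * s} \<union> (*) 2 ` {s<..K}"
  proof
    show "larger_parts K s \<subseteq> {s<..2 * s} \<union> (*) 2 ` {s<..K}"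
    proof
      fix p assume p: "p \<in> larger_parts K s"
      show "p \<in> {s<..2 * s} \<union> (*) 2 ` {s<..K}"
      proof (cases "p \<le> 2 * s")
        case False
        with p obtain k where "p = 2 * k"
          by (auto simp: larger_parts_def elim!: evenE)
        then show ?thesis using p False by (auto simp: larger_parts_def)
      qed (use p in \<open>auto simp: larger_parts_def\<close>)
    qed
  qed (use assms in \<open>auto simp: larger_parts_def\<close>)
  moreover have "{s<..2 * s} \<inter> (*) 2 ` {s<..K} = {}"
    by auto
  ultimately have 1: "(\<Prod>k\<in>larger_parts K s. 1 - fps_X ^ k :: real fps)
    = (\<Prod>k\<in>{s<..2 * s}. 1 - fps_X ^ k) * (\<Prod>k\<in>{s<..K}. 1 - fps_X ^ (2 * k))"
    by (simp add: prod.union_disjoint prod.reindex inj_on_def)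
  have 2: "qpoch fps_X s * (\<Prod>k\<in>{s<..2 * s}. 1 - fps_X ^ k) = (qpoch fps_X (2 * s) :: real fps)"
  proof -
    have "{1..2 * s} = {1..s} \<union> {s<..2 * s}" by auto
    then show ?thesis
      unfolding qpoch_def by (simp add: prod.union_disjoint ivl_disj_int)
  qed
  have 3: "even_prod s * (\<Prod>k\<in>{s<..K}. 1 - fps_X ^ (2 * k)) = even_prod K"
  proof -
    have "{1..K} = {1..s} \<union> {s<..K}" using assms by auto
    then show ?thesis
      unfolding even_prod_def by (simp add: prod.union_disjoint ivl_disj_int)
  qed
  have "(\<Prod>k\<in>larger_parts K s. 1 - fps_X ^ k) * qpoch fps_X s =
      qpoch fps_X s * (\<Prod>k\<in>{s<..2 * s}. 1 - fps_X ^ k)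
          * (\<Prod>k\<in>{s<..K}. 1 - fps_X ^ (2 * k) :: real fps)"
    unfolding 1 by (simp add: mult_ac)
  also have "\<dots> = qpoch_odd fps_X s * even_prod K"
    unfolding 2 qpoch_double 3[symmetric] by (simp add: mult_ac)
  finally show ?thesis .
qed

text \<open>The multiplier \<open>even_prod K\<close> is the same for every s, so a whole sum over s
  can be multiplied by it. The proof cancels a series with constant coefficient 1.\<close>

lemma count_gf_even_prod:
  assumes "1 \<le> s" "s \<le> K"
  shows "count_gf s (larger_parts K s) * even_prod K = fps_X ^ s * spt_coeff s"
proof -
  define L where "L = larger_parts K s"
  define p o' pd where "p = (qpoch fps_X s :: real fps)" and "o' = (qpoch_odd fps_X s :: real fps)"
    and "pd = (\<Prod>k\<in>L. 1 - fps_X ^ k :: real fps)"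
  define p' where "p' = (qpoch fps_X (s - 1) :: real fps)"
  have p: "p = p' * (1 - fps_X ^ s)"
    using assms by (cases s) (simp_all add: p_def p'_def)
  have L: "finite L" "0 \<notin> L" "s \<notin> L"
    by (auto simp: L_def larger_parts_def)
  have 1: "(1 - fps_X ^ s) ^ 2 * count_gf s L = fps_X ^ s * partition_gf L"
    using L assms by (intro count_gf_eq) auto
  have 2: "pd * partition_gf L = 1"
    unfolding pd_def using L by (intro partition_gf_prod)
  have 3: "pd * p = o' * even_prod K"
    unfolding pd_def p_def o'_def L_def using assms by (intro larger_parts_prod)
  have "(p * o') * (count_gf s L * even_prod K) = p * count_gf s L * (pd * p)"
    unfolding 3 by (simp add: mult_ac)
  also have "\<dots> = p' ^ 2 * pd * ((1 - fps_X ^ s) ^ 2 * count_gf s L)"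
    by (simp add: p power2_eq_square mult_ac)
  also have "\<dots> = p' ^ 2 * fps_X ^ s * (pd * partition_gf L)"
    unfolding 1 by (simp add: mult_ac)
  also have "\<dots> = (p * o') * (fps_X ^ s * spt_coeff s)"
    using spt_coeff_mult[of s] by (simp add: 2 p_def o'_def p'_def mult_ac)
  finally show ?thesis
  proof -
    have "p * o' \<noteq> 0"
    proof
      assume "p * o' = 0"
      then have "(p * o') $ 0 = 0 $ 0" by (rule arg_cong)
      then show False by (simp add: p_def o'_def)
    qed
    then show "(p * o') * (count_gf s L * even_prod K)
        = (p * o') * (fps_X ^ s * spt_coeff s) \<Longrightarrow> ?thesis"
      by (simp add: L_def)
  qed
qed

section \<open>Transfer of the finite identities to power series\<close>

lemma fps_to_fls_sum: "fps_to_fls (\<Sum>x\<in>A. f x) = (\<Sum>x\<in>A. fps_to_fls (f x))"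
  by (induction A rule: infinite_finite_induct) simp_all

lemma fps_to_fls_prod: "fps_to_fls (\<Prod>x\<in>A. f x :: real fps) = (\<Prod>x\<in>A. fps_to_fls (f x))"
  by (induction A rule: infinite_finite_induct) (simp_all add: fls_times_fps_to_fls)

lemma fps_to_fls_inverse:
  "f $ 0 \<noteq> 0 \<Longrightarrow> fps_to_fls (inverse f) = inverse (fps_to_fls (f :: real fps))"
  by (simp add: fls_inverse_fps_to_fls)

lemma fps_to_fls_qpoch: "fps_to_fls (qpoch fps_X n) = qpoch (fls_X :: real fls) n"
  unfolding qpoch_def by (simp add: fps_to_fls_prod fps_to_fls_power)

lemma fps_to_fls_qpoch_odd: "fps_to_fls (qpoch_odd fps_X n) = qpoch_odd (fls_X :: real fls) n"
  unfolding qpoch_odd_def by (simp add: fps_to_fls_prod fps_to_fls_power)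

lemma fps_to_fls_geo: "k > 0 \<Longrightarrow> fps_to_fls (geo k) = 1 / (1 - fls_X ^ k)"
  unfolding geo_def by (subst fps_to_fls_inverse) (simp_all add: fps_to_fls_power inverse_eq_divide)

lemma fps_to_fls_bailey_alpha: "fps_to_fls (bailey_alpha fps_X j)
    = bailey_alpha (fls_X :: real fls) j"
  unfolding bailey_alpha_def by (simp add: fls_times_fps_to_fls fps_to_fls_power)

lemma fps_to_fls_spt_coeff:
  "fps_to_fls (spt_coeff n) = qpoch fls_X (n - 1) ^ 2 / (qpoch fls_X n * qpoch_odd fls_X n)"
  unfolding spt_coeff_def fls_times_fps_to_fls
  by (subst fps_to_fls_inverse)
    (simp_all add: fls_times_fps_to_fls fps_to_fls_power fps_to_fls_qpoch fps_to_fls_qpoch_odd divide_inverse)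

lemmas fps_to_fls_simps = fps_to_fls_sum fps_to_fls_prod fps_to_fls_power fls_times_fps_to_fls
  fps_to_fls_qpoch fps_to_fls_geo fps_to_fls_bailey_alpha fps_to_fls_spt_coeff

lemma fls_X_power_neq_1: "k > 0 \<Longrightarrow> (fls_X :: real fls) ^ k \<noteq> 1"
proof
  assume "k > 0" "(fls_X :: real fls) ^ k = 1"
  then have "fps_to_fls (fps_X ^ k :: real fps) = fps_to_fls 1"
    by (simp add: fps_to_fls_power)
  then have "(fps_X ^ k :: real fps) = 1"
    by (rule fps_to_fls_eq_imp_fps_eq)
  then have "(fps_X ^ k :: real fps) $ 0 = 1 $ 0"
    by (rule arg_cong)
  with \<open>k > 0\<close> show False by simp
qed

lemma bailey_sum_fps:
  "(\<Sum>n=1..N. fps_X ^ n * spt_coeff n) = (\<Sum>n=1..N. fps_X ^ n * geo n ^ 2) +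
    (\<Sum>j=1..N div 2. bailey_alpha fps_X j * (fps_X ^ (2 * j) * geo (2 * j) ^ 2) *
      (qpoch fps_X N ^ 2 * inverse (qpoch fps_X (N - 2 * j) * qpoch fps_X (N + 2 * j))))"
  (is "?L = ?R")
proof -
  have inv: "fps_to_fls (inverse (qpoch fps_X a * qpoch fps_X b))
      = 1 / (qpoch (fls_X :: real fls) a * qpoch fls_X b)" for a b
    by (subst fps_to_fls_inverse) (simp_all add: fps_to_fls_simps inverse_eq_divide)
  have "fps_to_fls ?L = (\<Sum>n=1..N. fls_X ^ n
      * (qpoch fls_X (n - 1) ^ 2 / (qpoch fls_X n * qpoch_odd fls_X n)))"
    by (simp add: fps_to_fls_simps)
  also have "\<dots> = (\<Sum>n=1..N. fls_X ^ n / (1 - fls_X ^ n) ^ 2) +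
    (\<Sum>j=1..N div 2. bailey_alpha fls_X j * (fls_X ^ (2 * j) / (1 - fls_X ^ (2 * j)) ^ 2) *
      (qpoch fls_X N ^ 2 / (qpoch fls_X (N - 2 * j) * qpoch fls_X (N + 2 * j))))"
    by (rule bailey_sum) (simp_all add: fls_X_power_neq_1)
  also have "\<dots> = fps_to_fls ?R"
    unfolding fps_to_fls_plus fps_to_fls_sum
    by (intro arg_cong2[where f = "(+)"] sum.cong refl)
      (simp_all add: fps_to_fls_simps inv power_divide)
  finally show ?thesis
    by (rule fps_to_fls_eq_imp_fps_eq)
qed

lemma gauss_sum_fps:
  "(\<Sum>n=1..N. fps_X ^ (n * (n + 1) div 2) * spt_coeff n *
      (\<Prod>i<n. (1 - fps_X ^ (2 * (N - i))) * geo (2 * N - i)))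
    = (\<Sum>k=1..N. fps_X ^ (2 * k - 1) * geo (2 * k - 1) ^ 2)"
  (is "?L = ?R")
proof -
  have w: "fps_to_fls (\<Prod>i<n. (1 - fps_X ^ (2 * (N - i))) * geo (2 * N - i))
      = gauss_weight fls_X N n"
    if "n \<in> {1..N}" for n
    \<comment> \<open>Since i < n \<le> N, the exponent \<open>2 * N - i\<close> is positive, as the
      transfer of \<open>geo\<close> requires.\<close>
    unfolding gauss_weight_def fps_to_fls_prod using that
    by (intro prod.cong) (simp_all add: fps_to_fls_simps)
  have "fps_to_fls ?L = (\<Sum>n=1..N. gauss_term fls_X N n)"
    unfolding fps_to_fls_sum gauss_term_def
    by (intro sum.cong refl) (simp add: fls_times_fps_to_fls w, simp add: fps_to_fls_simps)
  also have "\<dots> = (\<Sum>k=1..N. fls_X ^ (2 * k - 1) / (1 - fls_X ^ (2 * k - 1))\<^sup>2)"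
    by (rule finite_gauss_second) (simp_all add: fls_X_power_neq_1)
  also have "\<dots> = fps_to_fls ?R"
    unfolding fps_to_fls_sum
    by (intro sum.cong refl) (simp add: fps_to_fls_simps power_divide)
  finally show ?thesis
    by (rule fps_to_fls_eq_imp_fps_eq)
qed

section \<open>Series without odd coefficients up to degree m\<close>

definition odd_vanishing :: "nat \<Rightarrow> real fps \<Rightarrow> bool" where
  "odd_vanishing m f \<longleftrightarrow> (\<forall>k\<le>m. odd k \<longrightarrow> f $ k = 0)"

lemma odd_vanishing_add: "odd_vanishing m f \<Longrightarrow> odd_vanishing m g \<Longrightarrow> odd_vanishing m (f + g)"
  by (simp add: odd_vanishing_def)

lemma odd_vanishing_uminus: "odd_vanishing m f \<Longrightarrow> odd_vanishing m (- f)"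
  by (simp add: odd_vanishing_def)

lemma odd_vanishing_diff: "odd_vanishing m f \<Longrightarrow> odd_vanishing m g \<Longrightarrow> odd_vanishing m (f - g)"
  by (simp add: odd_vanishing_def)

lemma odd_vanishing_sum: "(\<And>x. x \<in> A \<Longrightarrow> odd_vanishing m (f x)) \<Longrightarrow> odd_vanishing m (\<Sum>x\<in>A. f x)"
  by (simp add: odd_vanishing_def fps_sum_nth)

text \<open>If two indices add up to an odd k, one of them is odd.\<close>

lemma odd_vanishing_mult:
  assumes "odd_vanishing m f" "odd_vanishing m g"
  shows "odd_vanishing m (f * g)"
  unfolding odd_vanishing_def
proof (intro allI impI)
  fix k assume k: "k \<le> m" "odd k"
  have "f $ i * g $ (k - i) = 0" if "i \<le> k" for i
    using assms k that by (cases "odd i") (auto simp: odd_vanishing_def)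
  then show "(f * g) $ k = 0"
    unfolding fps_mult_nth by (intro sum.neutral) simp
qed

lemma odd_vanishing_1: "odd_vanishing m 1"
  by (auto simp: odd_vanishing_def elim: oddE)

lemma odd_vanishing_power: "odd_vanishing m f \<Longrightarrow> odd_vanishing m (f ^ n)"
  by (induction n) (simp_all add: odd_vanishing_1 odd_vanishing_mult)

lemma odd_vanishing_prod: "(\<And>x. x \<in> A \<Longrightarrow> odd_vanishing m (f x)) \<Longrightarrow> odd_vanishing m (\<Prod>x\<in>A. f x)"
  by (induction A rule: infinite_finite_induct) (simp_all add: odd_vanishing_1 odd_vanishing_mult)

lemma odd_vanishing_X_power: "even n \<Longrightarrow> odd_vanishing m (fps_X ^ n)"
  by (auto simp: odd_vanishing_def fps_X_power_nth)

text \<open>Truncation errors of order beyond m count as even, which lets finite identities replace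
  infinite ones.\<close>

lemma odd_vanishing_dvd: "fps_X ^ Suc m dvd f \<Longrightarrow> odd_vanishing m f"
  by (auto simp: odd_vanishing_def fps_X_power_mult_nth simp del: power_Suc elim!: dvdE)

text \<open>Strong induction on odd k: in coefficient k of \<open>inverse f * f\<close>, every
  product except \<open>inverse f $ k * f $ 0\<close> has a factor of odd index already known to
  vanish.\<close>

lemma odd_vanishing_inverse:
  assumes "odd_vanishing m f" "f $ 0 \<noteq> 0"
  shows "odd_vanishing m (inverse f)"
proof -
  have "k \<le> m \<Longrightarrow> odd k \<Longrightarrow> inverse f $ k = 0" for k
  proof (induction k rule: less_induct)
    case (less k)
    have "inverse f * f = 1"
      using assms by (intro inverse_mult_eq_1)
    then have "(inverse f * f) $ k = 0"
      using less.prems by (auto elim: oddE)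
    then have "(\<Sum>i=0..k. inverse f $ i * f $ (k - i)) = 0"
      by (simp add: fps_mult_nth)
    moreover have "inverse f $ i * f $ (k - i) = 0" if "i < k" for i
      using assms less that by (cases "odd i") (auto simp: odd_vanishing_def)
    ultimately have "inverse f $ k * f $ 0 = 0"
      by (simp add: sum.last_plus)
    then show ?case
      using assms by simp
  qed
  then show ?thesis
    by (simp add: odd_vanishing_def)
qed

lemma odd_vanishing_geo: "odd_vanishing m (geo (2 * k))" if "k > 0"
  unfolding geo_def using that
  by (intro odd_vanishing_inverse odd_vanishing_diff odd_vanishing_1 odd_vanishing_X_power) auto

lemma odd_vanishing_bailey_alpha: "odd_vanishing m (bailey_alpha fps_X j)"
proof -
  have "even (j * (3 * j - 1))" "even (j * (3 * j + 1))"
    by (cases j; simp)+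
  then have "odd_vanishing m (fps_X ^ (j * (3 * j - 1)) + fps_X ^ (j * (3 * j + 1)))"
    by (intro odd_vanishing_add odd_vanishing_X_power)
  then show ?thesis
    unfolding bailey_alpha_def
    by (intro odd_vanishing_mult odd_vanishing_power odd_vanishing_uminus odd_vanishing_1)
qed

section \<open>Truncation errors and comparison of the two sums\<close>

lemma qpoch_diff_dvd:
  assumes "a \<le> b"
  shows "fps_X ^ Suc a dvd (qpoch fps_X b - qpoch fps_X a :: real fps)"
  using assms
proof (induction b rule: dec_induct)
  case base
  then show ?case by simp
next
  case (step b)
  have "qpoch fps_X (Suc b) - qpoch fps_X a
      = (qpoch fps_X b - qpoch fps_X a) - qpoch fps_X b * (fps_X ^ Suc b :: real fps)"
    by (simp add: algebra_simps)
  moreover have "fps_X ^ Suc a dvd (fps_X ^ Suc b :: real fps)"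
    using step by (intro le_imp_power_dvd) simp
  ultimately show ?case
    using step.IH by (metis dvd_diff dvd_mult)
qed

text \<open>With a, b, c for the products at N - r, N, N + r, the numerator b^2 - a c equals (b - a)
  (b + a) - a (c - a), and both differences have order above N - r.\<close>

lemma bailey_factor_dvd:
  assumes "r \<le> N"
  shows "fps_X ^ Suc (N - r) dvd
    (qpoch fps_X N ^ 2 * inverse (qpoch fps_X (N - r) * qpoch fps_X (N + r)) - 1 :: real fps)"
proof -
  define a b c where "a = (qpoch fps_X (N - r) :: real fps)" and "b = (qpoch fps_X N :: real fps)"
    and "c = (qpoch fps_X (N + r) :: real fps)"
  have "fps_X ^ Suc (N - r) dvd b - a" "fps_X ^ Suc (N - r) dvd c - a"
    unfolding a_def b_def c_def by (intro qpoch_diff_dvd; simp)+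
  then have "fps_X ^ Suc (N - r) dvd (b - a) * (b + a) - a * (c - a)"
    by (intro dvd_diff[OF dvd_mult2 dvd_mult])
  also have "(b - a) * (b + a) - a * (c - a) = b ^ 2 - a * c"
    by (simp add: algebra_simps power2_eq_square)
  finally have "fps_X ^ Suc (N - r) dvd (b ^ 2 - a * c) * inverse (a * c)"
    by (rule dvd_mult2)
  moreover have "(a * c) * inverse (a * c) = 1"
    by (rule inverse_mult_eq_1') (simp add: a_def c_def)
  ultimately show ?thesis
    by (simp add: left_diff_distrib a_def b_def c_def)
qed

lemma odd_vanishing_plus:
  "odd_vanishing m ((\<Sum>n=1..m. fps_X ^ n * spt_coeff n) - (\<Sum>n=1..m. fps_X ^ n * geo n ^ 2))"
proof -
  have "odd_vanishing m (bailey_alpha fps_X j * (fps_X ^ (2 * j) * geo (2 * j) ^ 2) *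
      (qpoch fps_X m ^ 2 * inverse (qpoch fps_X (m - 2 * j) * qpoch fps_X (m + 2 * j))))"
    (is "odd_vanishing m (?a * (?X * ?g) * ?f)")
    if "j \<in> {1..m div 2}" for j
  proof -
    have j: "j > 0" "2 * j \<le> m"
      using that by auto
    \<comment> \<open>The factor X^(2 j) supplies exactly the 2 j orders missing from the error
      bound, raising it to m + 1.\<close>
    have "fps_X ^ (2 * j) * fps_X ^ Suc (m - 2 * j) dvd fps_X ^ (2 * j) * (?f - 1)"
      using bailey_factor_dvd[OF j(2)] by (intro mult_dvd_mono) auto
    also have "fps_X ^ (2 * j) * fps_X ^ Suc (m - 2 * j) = (fps_X ^ Suc m :: real fps)"
      unfolding power_add[symmetric] using j by simp
    finally have "odd_vanishing m (?X * (?f - 1))"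
      by (rule odd_vanishing_dvd)
    moreover have "odd_vanishing m ?X" "odd_vanishing m (?a * ?g)"
      using j by (intro odd_vanishing_mult odd_vanishing_bailey_alpha
          odd_vanishing_power[of _ "geo _"]
        odd_vanishing_geo odd_vanishing_X_power; simp)+
    ultimately have "odd_vanishing m (?a * ?g * (?X + ?X * (?f - 1)))"
      by (intro odd_vanishing_mult[OF _ odd_vanishing_add])
    moreover have "?a * ?g * (?X + ?X * (?f - 1)) = ?a * (?X * ?g) * ?f"
      by (simp add: algebra_simps)
    ultimately show ?thesis
      by simp
  qed
  then show ?thesis
    unfolding bailey_sum_fps add_diff_cancel_left' by (rule odd_vanishing_sum)
qed

text \<open>The separate length l allows induction on the number of factors while the order stays
  fixed by n. Each factor (1 - A) / (1 - B) differs from 1 by (B - A) / (1 - B), and both exponents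
  are at least 2 (N - n) + 2.\<close>

lemma gauss_factor_dvd:
  assumes "n \<le> N" "n > 0" "l \<le> n"
  shows "fps_X ^ (2 * (N - n) + 2) dvd ((\<Prod>i<l. (1 - fps_X ^ (2 * (N - i))) * geo (2 * N - i)) - 1)"
  using assms(3)
proof (induction l)
  case 0
  then show ?case by simp
next
  case (Suc l)
  define P where "P = (\<Prod>i<l. (1 - fps_X ^ (2 * (N - i))) * geo (2 * N - i))"
  define g where "g = geo (2 * N - l)"
  define A B where "A = (fps_X ^ (2 * (N - l)) :: real fps)"
    and "B = (fps_X ^ (2 * N - l) :: real fps)"
  have "(1 - B) * g = 1"
    unfolding B_def g_def using Suc assms by (intro geo_mult) auto
  moreover have "P * ((1 - A) * g) - 1 = (P - 1) + P * ((1 - B) * g - 1) + P * ((B - A) * g)"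
    by (simp add: algebra_simps)
  ultimately have "P * ((1 - A) * g) - 1 = (P - 1) + P * ((B - A) * g)"
    by simp
  moreover have "fps_X ^ (2 * (N - n) + 2) dvd (B - A) * g"
    unfolding A_def B_def using Suc assms by (intro dvd_mult2 dvd_diff le_imp_power_dvd) auto
  moreover have "fps_X ^ (2 * (N - n) + 2) dvd P - 1"
    unfolding P_def using Suc by simp
  ultimately have "fps_X ^ (2 * (N - n) + 2) dvd P * ((1 - A) * g) - 1"
    by (simp only: dvd_add dvd_mult)
  then show ?case
    unfolding P_def g_def A_def prod.lessThan_Suc .
qed

text \<open>\<open>gauss_sum_fps\<close> evaluates the weighted sum exactly; it remains to see that
  replacing each weight by 1 changes only orders above m.\<close>

lemma odd_vanishing_minus:
  "odd_vanishing m ((\<Sum>n=1..m. fps_X ^ (n * (n + 1) div 2) * spt_coeff n) -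
    (\<Sum>k=1..m. fps_X ^ (2 * k - 1) * geo (2 * k - 1) ^ 2))"
proof -
  have "odd_vanishing m (fps_X ^ (n * (n + 1) div 2) * spt_coeff n *
      (1 - (\<Prod>i<n. (1 - fps_X ^ (2 * (m - i))) * geo (2 * m - i))))"
      (is "odd_vanishing m (?X * _ * (1 - ?P))")
    if "n \<in> {1..m}" for n
  proof -
    have n: "n \<le> m" "n > 0"
      using that by auto
    have "fps_X ^ (n * (n + 1) div 2) * fps_X ^ (2 * (m - n) + 2) dvd ?X * (?P - 1)"
      using gauss_factor_dvd[OF n order.refl] by (intro mult_dvd_mono) auto
    moreover have "Suc m \<le> n * (n + 1) div 2 + (2 * (m - n) + 2)"
    proof -
      \<comment> \<open>Equivalent to (n - 1) (n - 2) \<ge> 0.\<close>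
      have "4 * n \<le> n * (n + 1) + 2"
      proof (cases "n \<le> 2")
        case True
        then have "n = 0 \<or> n = 1 \<or> n = 2" by auto
        then show ?thesis by auto
      next
        case False
        then have "3 * n \<le> n * n" by simp
        moreover have "n * (n + 1) = n * n + n" by simp
        ultimately show ?thesis by linarith
      qed
      then show ?thesis using n by linarith
    qed
    ultimately have "fps_X ^ Suc m dvd ?X * (?P - 1)"
      by (metis (no_types, lifting) dvd_trans le_imp_power_dvd power_add)
    then have "fps_X ^ Suc m dvd (- spt_coeff n) * (?X * (?P - 1))"
      by (rule dvd_mult)
    also have "(- spt_coeff n) * (?X * (?P - 1)) = ?X * spt_coeff n * (1 - ?P)"
      by (simp add: algebra_simps)
    finally show ?thesis
      by (rule odd_vanishing_dvd)
  qed
  then show ?thesis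
    unfolding gauss_sum_fps[symmetric] sum_subtractf[symmetric]
    by (intro odd_vanishing_sum) (simp add: algebra_simps)
qed

text \<open>Extend the first sum to 2 m and split it by parity of the index: the odd indices cancel,
  the even ones give even series, and those above m have order above m.\<close>

lemma odd_vanishing_lambert:
  "odd_vanishing m ((\<Sum>n=1..m. fps_X ^ n * geo n ^ 2)
      - (\<Sum>k=1..m. fps_X ^ (2 * k - 1) * geo (2 * k - 1) ^ 2))"
proof -
  define f where "f = (\<lambda>n. fps_X ^ n * geo n ^ 2)"
  have split: "(\<Sum>n=1..2 * k. f n) = (\<Sum>k=1..k. f (2 * k - 1)) + (\<Sum>k=1..k. f (2 * k))" for k
    by (induction k) (simp_all add: algebra_simps)
  have "{1..2 * m} = {1..m} \<union> {m<..2 * m}"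
    by auto
  then have "(\<Sum>n=1..2 * m. f n) = (\<Sum>n=1..m. f n) + (\<Sum>n\<in>{m<..2 * m}. f n)"
    by (simp add: sum.union_disjoint ivl_disj_int)
  then have eq: "(\<Sum>n=1..m. f n) - (\<Sum>k=1..m. f (2 * k - 1))
      = (\<Sum>k=1..m. f (2 * k)) - (\<Sum>n\<in>{m<..2 * m}. f n)"
    using split[of m] by (simp add: algebra_simps)
  have "odd_vanishing m (f n)" if "n \<in> {m<..2 * m}" for n
    using that unfolding f_def by (intro odd_vanishing_dvd dvd_mult2 le_imp_power_dvd) auto
  moreover have "odd_vanishing m (f (2 * k))" if "k \<in> {1..m}" for k
    using that unfolding f_def
    by (intro odd_vanishing_mult odd_vanishing_power[of _ "geo _"] odd_vanishing_geo
        odd_vanishing_X_power) auto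
  ultimately have "odd_vanishing m ((\<Sum>k=1..m. f (2 * k)) - (\<Sum>n\<in>{m<..2 * m}. f n))"
    by (intro odd_vanishing_diff odd_vanishing_sum)
  then show ?thesis
    unfolding eq[symmetric] unfolding f_def .
qed

text \<open>After multiplication by the even product E, the difference is a combination of the three
  preceding comparisons. Dividing by E preserves the vanishing, since E is even with constant
  coefficient 1.\<close>

lemma odd_vanishing_spt_diff:
  "odd_vanishing m ((\<Sum>s=1..m. fps_X ^ (s choose 2) * count_gf s (larger_parts m s)) -
    (\<Sum>s=1..m. count_gf s (larger_parts m s)))" (is "odd_vanishing m ?D")
proof -
  define E where "E = even_prod m"
  have "(\<Sum>s=1..m. fps_X ^ (s choose 2) * count_gf s (larger_parts m s)) * E
      = (\<Sum>s=1..m. fps_X ^ (s * (s + 1) div 2) * spt_coeff s)"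
    unfolding sum_distrib_right
  proof (intro sum.cong refl)
    fix s assume s: "s \<in> {1..m}"
    have "s * (s + 1) = s * (s - 1) + 2 * s"
      by (cases s) simp_all
    then have "s * (s + 1) div 2 = (s choose 2) + s"
      by (simp add: choose_two)
    then have "fps_X ^ (s * (s + 1) div 2) = (fps_X ^ (s choose 2) * fps_X ^ s :: real fps)"
      by (simp only: power_add)
    then show "fps_X ^ (s choose 2) * count_gf s (larger_parts m s) * E
        = fps_X ^ (s * (s + 1) div 2) * spt_coeff s"
      using count_gf_even_prod[of s m] s by (simp add: E_def mult.assoc)
  qed
  moreover have "(\<Sum>s=1..m. count_gf s (larger_parts m s)) * E = (\<Sum>s=1..m. fps_X ^ s * spt_coeff s)"
    unfolding sum_distrib_right E_def by (intro sum.cong refl count_gf_even_prod) auto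
  ultimately have "?D * E =
    ((\<Sum>s=1..m. fps_X ^ (s * (s + 1) div 2) * spt_coeff s)
        - (\<Sum>k=1..m. fps_X ^ (2 * k - 1) * geo (2 * k - 1) ^ 2))
    - ((\<Sum>s=1..m. fps_X ^ s * spt_coeff s) - (\<Sum>n=1..m. fps_X ^ n * geo n ^ 2))
    - ((\<Sum>n=1..m. fps_X ^ n * geo n ^ 2) - (\<Sum>k=1..m. fps_X ^ (2 * k - 1) * geo (2 * k - 1) ^ 2))"
    by (simp add: left_diff_distrib)
  then have DE: "odd_vanishing m (?D * E)"
    using odd_vanishing_minus odd_vanishing_plus odd_vanishing_lambert
        by (simp only: odd_vanishing_diff)
  have E0: "E $ 0 = 1"
    unfolding E_def even_prod_def by (induction m) simp_all
  have "odd_vanishing m E"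
    unfolding E_def even_prod_def
    by (intro odd_vanishing_prod odd_vanishing_diff odd_vanishing_1 odd_vanishing_X_power) auto
  then have "odd_vanishing m (?D * E * inverse E)"
    using E0 by (intro odd_vanishing_mult[OF DE] odd_vanishing_inverse) simp_all
  moreover have "E * inverse E = 1"
    using E0 by (intro inverse_mult_eq_1') simp
  ultimately show ?thesis
    by (simp only: mult.assoc mult_1_right)
qed

theorem theorem5:
  fixes n :: nat
  shows "spt_o_minus (2 * n + 1) = spt_o_plus (2 * n + 1)"
proof -
  \<comment> \<open>The bound m = 2 n + 1 is itself odd, so the top coefficient covered by the
    comparison is the required one.\<close>
  have "real (spt_o_minus (2 * n + 1)) = real (spt_o_plus (2 * n + 1))"
    using odd_vanishing_spt_diff[of "2 * n + 1"]
    unfolding spt_o_minus_gf spt_o_plus_gf by (simp add: odd_vanishing_def del: sum.cl_ivl_Suc)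
  then show ?thesis
    by simp
qed

end
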